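(* Let $\mathcal{M}$ be the set of all probability measures on $(\Omega,\mathcal{F})$, with the topology of weak convergence. For each $i\in\mathbb{N}$, the set $\{\mu\in\mathcal{M}:\mu=\mu\circ\lambda^{(i)}\}$ is closed in the topology of weak convergence. As a consequence, for each $k\in\mathbb{N}$ the set $\mathcal{P}_k$ of $\Lambda^k$-invariant measures in $\mathcal{M}$ is closed in the topology of weak convergence, and the set $\mathcal{P}$ of order-invariant measures in $\mathcal{M}$ is closed in the topology of weak convergence.
   Context: Notation: $\mathbb{N}=\{1,2,\dots\}$, $[k]=\{1,\dots,k\}$. Partial orders are strict. A suborder of $\mathbb{N}$ (or of $[k]$) is a partial order $<^{\mathbb{N}}$ on $\mathbb{N}$ (or $<^{[k]}$ on $[k]$) such that if $i$ is below $j$ in it then $i<j$ in the standard order. For a suborder $<^{\mathbb N}$, $<^{\mathbb N}_{[k]}$ denotes its restriction to $[k]$. The space: $\Omega$ is the set of pairs $\omega=(x_1x_2\cdots,<^{\mathbb{N}})$, where $x_1x_2\cdots$ is an infinite sequence of elements of $[0,1]$ and $<^{\mathbb{N}}$ is a suborder of $\mathbb{N}$. Encoding $<^{\mathbb N}$ by the indicator function of its set of related pairs, $\Omega$ is a closed subset of $[0,1]^{\mathbb N}\times\{0,1\}^{\{(i,j):i<j\}}$ and carries the product topology (compact metrizable). For Borel sets $B_1,\dots,B_k\subseteq[0,1]$ and a suborder $<^{[k]}$ of $[k]$, the basic event $E(B_1\cdots B_k,<^{[k]})$ is the set of $\omega=(x_1x_2\cdots,<^{\mathbb{N}})\in\Omega$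 with $x_i\in B_i$ for $i=1,\dots,k$ and $<^{\mathbb{N}}_{[k]}$ equal to $<^{[k]}$. $\mathcal{F}$ is the $\sigma$-field generated by all basic events; it is the Borel $\sigma$-field of $\Omega$. Weak convergence of probability measures on $(\Omega,\mathcal F)$ is with respect to this topology. Order-invariance: a linear extension of a suborder $<^{[k]}$ is a permutation $\lambda$ of $[k]$ such that $\lambda(i)<^{[k]}\lambda(j)$ implies $i<j$; $\lambda[<^{[k]}]$ is the suborder of $[k]$ in which $i$ is below $j$ if and only if $\lambda(i)<^{[k]}\lambda(j)$. A probability measure $\mu$ on $(\Omega,\mathcal{F})$ is order-invariant if $\mu(E(B_1\cdots B_k,<^{[k]}))=\mu(E(B_{\lambda(1)}\cdots B_{\lambda(k)},\lambda[<^{[k]}]))$ for all $k$, all Borel sets $B_1,\dots,B_k\subseteq[0,1]$, all suborders $<^{[k]}$ of $[k]$ and all linear extensions $\lambda$ of $<^{[k]}$. The maps $\lambda^{(i)}$: for $i\in\mathbb{N}$, $\lambda^{(i)}$ is the permutation of $\mathbb{N}$ exchanging $i$ and $i+1$ and fixing everything else. It acts on $\Omega$ as follows: for $\omega=(x_1x_2\cdots,<^{\mathbb N})$, if $i$ and $i+1$ are incomparable in $<^{\mathbb N}$ then $\lambda^{(i)}[\omega]=(x_{\lambda^{(i)}(1)}x_{\lambda^{(i)}(2)}\cdots,\lambda^{(i)}[<^{\mathbb N}])$, where $j$ is below $\ell$ in $\lambda^{(i)}[<^{\mathbb N}]$ iff $\lambda^{(i)}(j)<^{\mathbb N}\lambda^{(i)}(\ell)$;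 if $i<^{\mathbb N}i+1$ then $\lambda^{(i)}[\omega]=\omega$. This is a measurable involution of $\Omega$. Set $\lambda^{(i)}(E)=\{\lambda^{(i)}[\omega]:\omega\in E\}$ and $(\mu\circ\lambda^{(i)})(E)=\mu(\lambda^{(i)}(E))$ for $E\in\mathcal F$. For $k\in\mathbb N$, $\mu$ is $\Lambda^k$-invariant if $\mu\circ\lambda^{(i)}=\mu$ for every $i\in\{1,\dots,k-1\}$. *)

theory Defs
  imports "HOL-Probability.Probability" "HOL-Combinatorics.Combinatorics"
begin

text \<open>
  The positive integers are the set \<open>{1..}\<close> of naturals. A sequence \<open>x\<^sub>1 x\<^sub>2 \<dots>\<close> in the unit interval is
  an element of \<open>{1..} \<rightarrow>\<^sub>E {0..1}\<close>, so its value at the unused index 0 is pinned to \<open>undefined\<close>.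
  A strict order is a binary predicate that is false outside its ground set.
\<close>

type_synonym point = "(nat \<Rightarrow> real) \<times> (nat \<Rightarrow> nat \<Rightarrow> bool)"

definition suborder :: "nat set \<Rightarrow> (nat \<Rightarrow> nat \<Rightarrow> bool) \<Rightarrow> bool" where
  "suborder A R \<longleftrightarrow> irreflp R \<and> transp R \<and> (\<forall>i j. R i j \<longrightarrow> i \<in> A \<and> j \<in> A \<and> i < j)"

definition restrict_order :: "nat \<Rightarrow> (nat \<Rightarrow> nat \<Rightarrow> bool) \<Rightarrow> nat \<Rightarrow> nat \<Rightarrow> bool" where
  "restrict_order k R = (\<lambda>i j. i \<in> {1..k} \<and> j \<in> {1..k} \<and> R i j)"

text \<open>
  The topology on \<open>\<Omega>\<close> is the one induced by the type-class topology of \<open>point\<close>, i.e. the product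
  topology, where \<open>bool\<close> is discrete. The coordinates outside \<open>i < j\<close> and the coordinate 0 are
  constant on \<open>\<Omega>\<close> and hence do not matter.
\<close>

definition Omega :: "point set" where
  "Omega = {(x, R). x \<in> {1..} \<rightarrow>\<^sub>E {0..1} \<and> suborder {1..} R}"

definition basic_event ::
    "nat \<Rightarrow> (nat \<Rightarrow> real set) \<Rightarrow> (nat \<Rightarrow> nat \<Rightarrow> bool) \<Rightarrow> point set" where
  "basic_event k B R =
     {(x, S). (x, S) \<in> Omega \<and> (\<forall>i\<in>{1..k}. x i \<in> B i) \<and> restrict_order k S = R}"

definition unit_borel_seq :: "nat \<Rightarrow> (nat \<Rightarrow> real set) \<Rightarrow> bool" where
  "unit_borel_seq k B \<longleftrightarrow> (\<forall>i\<in>{1..k}. B i \<in> sets borel \<and> B i \<subseteq> {0..1})"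

definition event_algebra :: "point set set" where
  "event_algebra = sigma_sets Omega
     {basic_event k B R | k B R. 1 \<le> k \<and> unit_borel_seq k B \<and> suborder {1..k} R}"

definition prob_measures :: "point measure set" where
  "prob_measures = {\<mu>. prob_space \<mu> \<and> space \<mu> = Omega \<and> sets \<mu> = event_algebra}"

text \<open>
  The topology of weak convergence: the coarsest topology on the set of probability measures making
  \<open>\<mu> \<mapsto> \<integral> f d\<mu>\<close> continuous for every bounded continuous real function \<open>f\<close> on \<open>\<Omega>\<close>.
\<close>

definition weak_topology :: "point measure topology" where
  "weak_topology = topology_generated_by
     {{\<mu> \<in> prob_measures. (\<integral>\<omega>. f \<omega> \<partial>\<mu>) \<in> U} | (f :: point \<Rightarrow> real) U.
        continuous_on Omega f \<and> bounded (f ` Omega) \<and> open U}"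

lemma topspace_weak_topology: "topspace weak_topology = prob_measures"
proof -
  have "prob_measures \<in> {{\<mu> \<in> prob_measures. (\<integral>\<omega>. f \<omega> \<partial>\<mu>) \<in> U} | (f :: point \<Rightarrow> real) U.
        continuous_on Omega f \<and> bounded (f ` Omega) \<and> open U}"
    by (intro CollectI exI[of _ "\<lambda>_. 0"] exI[of _ UNIV]) (auto simp: bounded_iff)
  then show ?thesis
    unfolding weak_topology_def topology_generated_by_topspace by blast
qed

definition permute_order ::
    "(nat \<Rightarrow> nat) \<Rightarrow> (nat \<Rightarrow> nat \<Rightarrow> bool) \<Rightarrow> nat \<Rightarrow> nat \<Rightarrow> bool" where
  "permute_order l R = (\<lambda>i j. R (l i) (l j))"

definition linear_extension :: "nat \<Rightarrow> (nat \<Rightarrow> nat \<Rightarrow> bool) \<Rightarrow> (nat \<Rightarrow> nat) \<Rightarrow> bool" where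
  "linear_extension k R l \<longleftrightarrow>
     l permutes {1..k} \<and> (\<forall>i\<in>{1..k}. \<forall>j\<in>{1..k}. R (l i) (l j) \<longrightarrow> i < j)"

definition order_invariant :: "point measure \<Rightarrow> bool" where
  "order_invariant \<mu> \<longleftrightarrow>
     (\<forall>k\<ge>1. \<forall>B R l. unit_borel_seq k B \<longrightarrow> suborder {1..k} R \<longrightarrow> linear_extension k R l \<longrightarrow>
        emeasure \<mu> (basic_event k B R) =
        emeasure \<mu> (basic_event k (\<lambda>i. B (l i)) (permute_order l R)))"

definition swap_map :: "nat \<Rightarrow> point \<Rightarrow> point" where
  "swap_map i = (\<lambda>(x, R).
     if \<not> R i (i + 1) \<and> \<not> R (i + 1) i
     then (\<lambda>j. x (Transposition.transpose i (i + 1) j), permute_order (Transposition.transpose i (i + 1)) R)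
     else (x, R))"

text \<open>
  \<open>\<mu> \<circ> \<lambda>\<^bsup>(i)\<^esup>\<close> as a set function (forward image); two measures on \<open>(\<Omega>, \<F>)\<close> are equal iff they agree
  on every set of \<open>\<F>\<close>.
\<close>

definition comp_swap :: "point measure \<Rightarrow> nat \<Rightarrow> point set \<Rightarrow> ennreal" where
  "comp_swap \<mu> i E = emeasure \<mu> (swap_map i ` E)"

definition swap_invariant :: "nat \<Rightarrow> point measure \<Rightarrow> bool" where
  "swap_invariant i \<mu> \<longleftrightarrow> (\<forall>E\<in>event_algebra. emeasure \<mu> E = comp_swap \<mu> i E)"

definition Lambda_invariant :: "nat \<Rightarrow> point measure \<Rightarrow> bool" where
  "Lambda_invariant k \<mu> \<longleftrightarrow> (\<forall>i\<in>{1..<k}. swap_invariant i \<mu>)"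

end

theory Submission
  imports Defs
begin

text \<open>
  Each of the three kinds of invariance can be written as a family of conditions of one shape:
  two subsets \<open>C\<close> and \<open>D\<close> of \<open>\<Omega>\<close> that are both open and closed carry continuous maps \<open>T\<close> and
  \<open>S\<close>, and the image under \<open>T\<close> of \<open>\<mu>\<close> restricted to \<open>C\<close> equals the image under \<open>S\<close> of \<open>\<mu>\<close>
  restricted to \<open>D\<close>. Such a condition is closed (\<open>closedin_equal_pushforwards\<close>). Indeed, two
  finite Borel measures are equal as soon as they give the same integral to every bounded
  continuous \<open>f\<close>, so the condition says that the integral of \<open>1\<^sub>C \<cdot> (f \<circ> T) - 1\<^sub>D \<cdot> (f \<circ> S)\<close> under
  \<open>\<mu>\<close> vanishes for every such \<open>f\<close>. The integrand is bounded and continuous because \<open>C\<close> and \<open>D\<close>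
  are clopen, so the integral depends continuously on \<open>\<mu>\<close>, and an intersection of closed sets is
  closed.

  For \<open>\<lambda>\<^bsup>(i)\<^esup>\<close> one compares the identity with the map \<open>\<lambda>\<^bsup>(i)\<^esup>\<close> on all of \<open>\<Omega>\<close>. That map is continuous
  because whether \<open>i\<close> and \<open>i + 1\<close> are comparable is a clopen condition, and since it is an
  involution the images of events are preimages. The statement about \<open>\<Lambda>\<^bsup>k\<^esup>\<close>-invariance follows by
  intersecting.

  Order-invariance is handled directly, without factoring a linear extension into adjacent
  transpositions. For fixed \<open>k\<close>, \<open>R\<close> and \<open>l\<close> it compares the event that the order on \<open>[k]\<close> is \<open>R\<close>
  with the event that it is \<open>l[R]\<close>. Both are clopen, and equality of the measures of all
  basic events means that \<open>(x\<^bsub>l(1)\<^esub>, \<dots>, x\<^bsub>l(k)\<^esub>)\<close> on the first has the same law as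
  \<open>(x\<^sub>1, \<dots>, x\<^sub>k)\<close> on the second (\<open>basic_events_agree_iff\<close>).
\<close>

section \<open>Continuity and measurability in coordinates\<close>

text \<open>
  Second countability of the discrete two-point space makes the Borel sets of \<open>point\<close> the product
  \<open>\<sigma>\<close>-algebra, so that measurability can be checked on coordinates.
\<close>

instance bool :: second_countable_topology
proof
  have "generate_topology {{True}, {False}} U" for U :: "bool set"
  proof -
    have *: "generate_topology {{True}, {False}} {b}" for b
      by (cases b) (auto intro: generate_topology.Basis)
    have "generate_topology {{True}, {False}} (\<Union>((\<lambda>b. {b}) ` U))"
      by (rule generate_topology.UN) (use * in auto)
    then show ?thesis by simp
  qed
  then have "open U = generate_topology {{True}, {False}} U" for U :: "bool set"
    using Topological_Spaces.open_discrete[of U] by simp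
  then have "(open :: bool set \<Rightarrow> bool) = generate_topology {{True}, {False}}"
    by (rule ext)
  then show "\<exists>B::bool set set. countable B \<and> open = generate_topology B"
    by (intro exI[of _ "{{True}, {False}}"]) simp
qed

lemma continuous_on_label: "continuous_on A (\<lambda>\<omega>::point. fst \<omega> i)"
  by (rule continuous_on_product_then_coordinatewise[OF continuous_on_fst[OF continuous_on_id]])

lemma continuous_on_relation: "continuous_on A (\<lambda>\<omega>::point. snd \<omega> i j)"
  by (rule continuous_on_product_then_coordinatewise[OF continuous_on_product_then_coordinatewise[OF
        continuous_on_snd[OF continuous_on_id]]])

lemma continuous_on_point:
  fixes f :: "'a::topological_space \<Rightarrow> point"
  assumes "\<And>i. continuous_on A (\<lambda>a. fst (f a) i)" "\<And>i j. continuous_on A (\<lambda>a. snd (f a) i j)"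
  shows "continuous_on A f"
proof -
  have "continuous_on A (\<lambda>a. (fst (f a), snd (f a)))"
    by (intro continuous_on_Pair continuous_on_coordinatewise_then_product assms)
  then show ?thesis by simp
qed

lemma clopen_relation: "open {\<omega>::point. snd \<omega> i j = b}" "closed {\<omega>::point. snd \<omega> i j = b}"
proof -
  have *: "open {\<omega>::point. snd \<omega> i j = b}" for b
    using open_vimage[OF Topological_Spaces.open_discrete[of "{b}"] continuous_on_relation[of UNIV i j]]
    by (simp add: vimage_def)
  show "open {\<omega>::point. snd \<omega> i j = b}" by (rule *)
  have "- {\<omega>::point. snd \<omega> i j = b} = {\<omega>. snd \<omega> i j = (\<not> b)}" by auto
  then show "closed {\<omega>::point. snd \<omega> i j = b}"
    using *[of "\<not> b"] by (simp add: closed_def)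
qed

text \<open>
  Only the finitely many coordinates in \<open>{1..k} \<times> {1..k}\<close> are prescribed; if \<open>R\<close> relates anything
  outside \<open>{1..k}\<close>, the set is empty.
\<close>

lemma clopen_restrict_order:
  "open {\<omega>::point. restrict_order k (snd \<omega>) = R}" "closed {\<omega>::point. restrict_order k (snd \<omega>) = R}"
proof -
  define C where "C = {\<omega>::point. restrict_order k (snd \<omega>) = R}"
  define D where "D = (\<Inter>i\<in>{1..k}. \<Inter>j\<in>{1..k}. {\<omega>::point. snd \<omega> i j = R i j})"
  have D: "open D" "closed D"
    unfolding D_def
    by (intro open_INT closed_INT ballI clopen_relation finite_atLeastAtMost)+
  have "C = {} \<or> C = D"
  proof (cases "\<forall>i j. R i j \<longrightarrow> i \<in> {1..k} \<and> j \<in> {1..k}")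
    case True
    have "restrict_order k S = R \<longleftrightarrow> (\<forall>i\<in>{1..k}. \<forall>j\<in>{1..k}. S i j = R i j)" for S
      unfolding restrict_order_def fun_eq_iff using True by meson
    then show ?thesis by (auto simp: C_def D_def)
  next
    case False
    then have "C = {}" by (auto simp: C_def restrict_order_def)
    then show ?thesis ..
  qed
  then have "open C \<and> closed C" using D by auto
  then show "open {\<omega>::point. restrict_order k (snd \<omega>) = R}" "closed {\<omega>::point. restrict_order k (snd \<omega>) = R}"
    by (simp_all add: C_def)
qed

lemma continuous_on_If_clopen:
  assumes "open C" "closed C" "continuous_on (A \<inter> C) f" "continuous_on (A - C) g"
  shows "continuous_on A (\<lambda>x. if x \<in> C then f x else g x)"
proof -
  have A: "A = (A \<inter> C) \<union> (A - C)" by blast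
  have "A - C = A \<inter> (- C)" by blast
  then have "closedin (top_of_set A) (A \<inter> C)" "closedin (top_of_set A) (A - C)"
    using assms(1,2) by (auto intro!: closedin_closed_Int simp: closed_Compl)
  then show ?thesis
    using continuous_on_cases_local[of "A \<inter> C" "A - C" f g "\<lambda>x. x \<in> C"] assms(3,4)
    by (simp flip: A)
qed

lemma borel_measurable_bool:
  assumes "Measurable.pred M P"
  shows "P \<in> borel_measurable M"
proof -
  have *: "sets (borel :: bool measure) = sets (count_space UNIV)"
    by (auto intro: borel_open simp: Topological_Spaces.open_discrete)
  show ?thesis using assms by (simp add: measurable_cong_sets[OF refl *])
qed

lemma borel_measurable_point:
  fixes f :: "'a \<Rightarrow> point"
  assumes "\<And>i. (\<lambda>a. fst (f a) i) \<in> borel_measurable M"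
    and "\<And>i j. Measurable.pred M (\<lambda>a. snd (f a) i j)"
  shows "f \<in> borel_measurable M"
proof -
  have "(\<lambda>a. (fst (f a), snd (f a))) \<in> borel_measurable M"
    by (intro borel_measurable_Pair measurable_coordinatewise_then_product borel_measurable_bool assms)
  then show ?thesis by simp
qed

section \<open>Bounded continuous functions determine a measure\<close>

text \<open>
  Cozero sets are used in place of arbitrary open sets: the indicator of \<open>{f > 0}\<close> is the limit
  of \<open>min 1 (n \<cdot> f\<^sup>+)\<close>, so no metric on \<open>point\<close> has to be chosen.
\<close>

definition cozero_sets :: "point set set" where
  "cozero_sets = {{\<omega>. 0 < f \<omega>} | f::point \<Rightarrow> real. continuous_on UNIV f \<and> bounded (range f)}"

text \<open>
  The \<open>\<sigma>\<close>-algebra generated by the cozero sets makes every coordinate measurable, since the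
  coordinates are continuous, and the coordinates generate the Borel sets.
\<close>

lemma sets_borel_cozero: "sets (borel :: point measure) = sigma_sets UNIV cozero_sets"
proof
  show "sigma_sets UNIV cozero_sets \<subseteq> sets (borel :: point measure)"
  proof (rule sets.sigma_sets_subset[of _ borel, simplified])
    show "cozero_sets \<subseteq> sets borel"
      by (auto simp: cozero_sets_def intro!: borel_open open_Collect_less)
  qed
  let ?M = "sigma UNIV cozero_sets"
  have [simp]: "sets ?M = sigma_sets UNIV cozero_sets" "space ?M = UNIV" by simp_all
  have cozero: "{\<omega>. 0 < f \<omega>} \<in> sets ?M" if "continuous_on UNIV f" "range f \<subseteq> {0..1}" for f :: "point \<Rightarrow> real"
    using that by (auto simp: cozero_sets_def intro!: sigma_sets.Basic exI[of _ f] intro: bounded_subset[OF bounded_closed_interval])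
  have "(\<lambda>\<omega>. \<omega>) \<in> borel_measurable ?M"
  proof (rule borel_measurable_point)
    fix i
    show "(\<lambda>\<omega>. fst \<omega> i) \<in> borel_measurable ?M"
    proof (rule borel_measurable_iff_greater[THEN iffD2, rule_format])
      fix a :: real
      \<comment> \<open>Truncation of \<open>fst \<omega> i - a\<close> keeps the function bounded without moving its cozero set.\<close>
      have "{\<omega> \<in> space ?M. a < fst \<omega> i} = {\<omega>. 0 < max 0 (min 1 (fst \<omega> i - a))}" by auto
      also have "\<dots> \<in> sets ?M"
        by (rule cozero) (auto intro!: continuous_intros continuous_on_label)
      finally show "{\<omega> \<in> space ?M. a < fst \<omega> i} \<in> sets ?M" .
    qed
  next
    fix i j
    have "continuous_on UNIV ((of_bool :: bool \<Rightarrow> real) \<circ> (\<lambda>\<omega>::point. snd \<omega> i j))"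
      by (intro continuous_on_compose continuous_on_relation Topological_Spaces.continuous_on_discrete)
    then have "{\<omega>::point. 0 < (of_bool (snd \<omega> i j) :: real)} \<in> sets ?M"
      by (intro cozero) (auto simp: o_def)
    then show "Measurable.pred ?M (\<lambda>\<omega>. snd \<omega> i j)"
      unfolding pred_def by simp
  qed
  from measurable_sets[OF this]
  show "sets (borel :: point measure) \<subseteq> sigma_sets UNIV cozero_sets" by auto
qed

text \<open>
  Equal integrals give equal measure to each cozero set by dominated convergence, and the cozero
  sets are closed under intersection, because \<open>{f > 0} \<inter> {g > 0} = {min f g > 0}\<close>, and generate
  the Borel sets.
\<close>

lemma measure_eqI_bounded_continuous:
  fixes M N :: "point measure"
  assumes M: "finite_measure M" "sets M = sets borel" and N: "finite_measure N" "sets N = sets borel"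
    and eq: "\<And>f :: point \<Rightarrow> real. continuous_on UNIV f \<Longrightarrow> bounded (range f) \<Longrightarrow> (\<integral>\<omega>. f \<omega> \<partial>M) = (\<integral>\<omega>. f \<omega> \<partial>N)"
  shows "M = N"
proof (rule measure_eqI_generator_eq)
  show "Int_stable cozero_sets"
  proof (rule Int_stableI)
    fix a b assume "a \<in> cozero_sets" "b \<in> cozero_sets"
    then obtain f g :: "point \<Rightarrow> real" where
      f: "a = {\<omega>. 0 < f \<omega>}" "continuous_on UNIV f" "bounded (range f)" and
      g: "b = {\<omega>. 0 < g \<omega>}" "continuous_on UNIV g" "bounded (range g)"
      by (auto simp: cozero_sets_def)
    obtain c d where "\<And>\<omega>. \<bar>f \<omega>\<bar> \<le> c" "\<And>\<omega>. \<bar>g \<omega>\<bar> \<le> d"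
      using f(3) g(3) by (auto simp: bounded_iff)
    then have "\<bar>min (f \<omega>) (g \<omega>)\<bar> \<le> max c d" for \<omega>
      by (metis max.coboundedI1 max.coboundedI2 min_def)
    then have "bounded (range (\<lambda>\<omega>. min (f \<omega>) (g \<omega>)))"
      by (auto simp: bounded_iff)
    then show "a \<inter> b \<in> cozero_sets"
      using f g unfolding cozero_sets_def
      by (intro CollectI exI[of _ "\<lambda>\<omega>. min (f \<omega>) (g \<omega>)"]) (auto intro!: continuous_intros)
  qed
  show "cozero_sets \<subseteq> Pow UNIV" by simp
  show "sets M = sigma_sets UNIV cozero_sets" "sets N = sigma_sets UNIV cozero_sets"
    using M N sets_borel_cozero by simp_all
  have "UNIV \<in> cozero_sets"
    by (auto simp: cozero_sets_def intro!: exI[of _ "\<lambda>_. 1"])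
  then show "range (\<lambda>_::nat. UNIV) \<subseteq> cozero_sets" by simp
  show "(\<Union>i::nat. UNIV) = (UNIV :: point set)" by simp
  show "emeasure M UNIV \<noteq> \<infinity>"
    using M(1) by (simp add: finite_measure.emeasure_eq_measure)
  fix X assume "X \<in> cozero_sets"
  then obtain f :: "point \<Rightarrow> real" where
      f: "X = {\<omega>. 0 < f \<omega>}" "continuous_on UNIV f" "bounded (range f)"
      by (auto simp: cozero_sets_def)
  define h where "h n \<omega> = min 1 (real n * max 0 (f \<omega>))" for n \<omega>
  have h: "continuous_on UNIV (h n)" for n
    unfolding h_def using f(2) by (auto intro!: continuous_intros)
  have h01: "norm (h n \<omega>) \<le> 1" for n \<omega> by (auto simp: h_def)
  have X: "X \<in> sets borel" using f by (auto intro!: borel_open open_Collect_less)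
  have lim: "(\<lambda>n. h n \<omega>) \<longlonglongrightarrow> indicator X \<omega>" for \<omega>
  proof (cases "\<omega> \<in> X")
    case True
    then have pos: "0 < f \<omega>" by (simp add: f)
    obtain m where m: "1 / f \<omega> < real m" using reals_Archimedean2 by blast
    have "h n \<omega> = 1" if "n \<ge> m" for n
    proof -
      have "1 < real m * f \<omega>" using m pos by (simp add: field_simps)
      also have "\<dots> \<le> real n * f \<omega>" using that pos by simp
      finally show ?thesis using pos by (simp add: h_def)
    qed
    then show ?thesis
      using True by (intro tendsto_eventually) (auto simp: eventually_sequentially)
  qed (auto simp: f h_def)
  have conv: "(\<lambda>n. \<integral>\<omega>. h n \<omega> \<partial>K) \<longlonglongrightarrow> measure K X"
    if K: "finite_measure K" "sets K = sets borel" for K :: "point measure"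
  proof -
    interpret finite_measure K by fact
    have "(\<lambda>n. \<integral>\<omega>. h n \<omega> \<partial>K) \<longlonglongrightarrow> (\<integral>\<omega>. indicator X \<omega> \<partial>K)"
    proof (rule integral_dominated_convergence[where w = "\<lambda>_. 1"])
      show "h n \<in> borel_measurable K" for n
        using borel_measurable_continuous_onI[OF h[of n]] by (simp add: measurable_cong_sets[OF K(2) refl])
    qed (use X K lim h01 in auto)
    then show ?thesis using X K by (simp add: sets_eq_imp_space_eq)
  qed
  have "(\<integral>\<omega>. h n \<omega> \<partial>M) = (\<integral>\<omega>. h n \<omega> \<partial>N)" for n
    by (rule eq[OF h]) (use h01 in \<open>auto simp: bounded_iff\<close>)
  with conv[OF M] conv[OF N] have "measure M X = measure N X"
    by (simp add: LIMSEQ_unique)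
  then show "emeasure M X = emeasure N X"
    using M(1) N(1) by (simp add: finite_measure.emeasure_eq_measure)
qed

section \<open>Events are the Borel subsets of \<open>\<Omega>\<close>\<close>

lemma suborder_restrict_order: "suborder {1..} S \<Longrightarrow> suborder {1..k} (restrict_order k S)"
  unfolding suborder_def restrict_order_def irreflp_def transp_def by blast

lemma finite_suborders: "finite {R. suborder {1..k} R}"
proof (rule finite_subset)
  show "{R. suborder {1..k} R} \<subseteq> (\<lambda>P i j. (i, j) \<in> P) ` Pow ({1..k} \<times> {1..k})"
  proof
    fix R assume "R \<in> {R. suborder {1..k} R}"
    then have "R = (\<lambda>i j. (i, j) \<in> {(i, j). R i j})" "{(i, j). R i j} \<in> Pow ({1..k} \<times> {1..k})"
      by (auto simp: suborder_def)
    then show "R \<in> (\<lambda>P i j. (i, j) \<in> P) ` Pow ({1..k} \<times> {1..k})" by (rule image_eqI)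
  qed
qed simp

text \<open>
  A basic event is cut out of \<open>\<Omega>\<close> by finitely many Borel conditions on coordinates. Conversely, a
  condition on one coordinate is a finite union of basic events, one for each possible order on
  an initial segment that contains the indices involved.
\<close>

lemma event_algebra_borel: "event_algebra = sets (restrict_space borel Omega)"
proof
  let ?G = "{basic_event k B R | k B R. 1 \<le> k \<and> unit_borel_seq k B \<and> suborder {1..k} R}"
  have label: "(\<lambda>\<omega>::point. fst \<omega> i) \<in> borel_measurable borel" for i
    by (intro borel_measurable_continuous_onI continuous_on_label)
  have "basic_event k B R \<in> sets (restrict_space borel Omega)" if "unit_borel_seq k B" for k B R
  proof -
    have "basic_event k B R = Omega \<inter>
        ((\<Inter>i\<in>{1..k}. (\<lambda>\<omega>. fst \<omega> i) -` B i \<inter> space borel) \<inter> {\<omega>. restrict_order k (snd \<omega>) = R})"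
      if "1 \<le> k" using that by (auto simp: basic_event_def)
    moreover have "basic_event k B R = Omega \<inter> {\<omega>. restrict_order k (snd \<omega>) = R}"
      if "k = 0" using that by (auto simp: basic_event_def)
    moreover have "(\<Inter>i\<in>{1..k}. (\<lambda>\<omega>::point. fst \<omega> i) -` B i \<inter> space borel) \<in> sets borel" if "1 \<le> k"
      using that \<open>unit_borel_seq k B\<close>
      by (intro sets.finite_INT) (auto intro!: measurable_sets[OF label] simp: unit_borel_seq_def simp del: space_borel)
    moreover have "{\<omega>::point. restrict_order k (snd \<omega>) = R} \<in> sets borel"
      by (rule borel_open[OF clopen_restrict_order(1)])
    ultimately show ?thesis
      by (cases "k = 0") (auto simp: sets_restrict_space)
  qed
  then have "?G \<subseteq> sets (restrict_space borel Omega)" by blast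
  from sets.sigma_sets_subset[OF this]
  show "event_algebra \<subseteq> sets (restrict_space borel Omega)"
    by (simp add: event_algebra_def space_restrict_space)
next
  let ?G = "{basic_event k B R | k B R. 1 \<le> k \<and> unit_borel_seq k B \<and> suborder {1..k} R}"
  define M where "M = sigma Omega ?G"
  have "?G \<subseteq> Pow Omega" by (auto simp: basic_event_def)
  then have M: "space M = Omega" "sets M = event_algebra"
    by (simp_all add: M_def event_algebra_def)
  have basic: "basic_event k B R \<in> sets M" if "1 \<le> k" "unit_borel_seq k B" "suborder {1..k} R" for k B R
    using that unfolding M event_algebra_def by (intro sigma_sets.Basic) blast
  have "(\<lambda>\<omega>. \<omega>) \<in> borel_measurable M"
  proof (rule borel_measurable_point)
    fix i
    show "(\<lambda>\<omega>. fst \<omega> i) \<in> borel_measurable M"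
    proof (cases "i = 0")
      case True
      \<comment> \<open>Index 0 lies outside the positive integers, so this coordinate is constant on \<open>\<Omega>\<close>.\<close>
      then have "fst \<omega> i = undefined" if "\<omega> \<in> space M" for \<omega>
        using that by (auto simp: M Omega_def)
      then show ?thesis using measurable_cong[of M "\<lambda>\<omega>. fst \<omega> i" "\<lambda>_. undefined" borel] by simp
    next
      case False
      show ?thesis
      proof (rule measurableI)
        fix A :: "real set" assume A: "A \<in> sets borel"
        define B where "B j = (if j = i then A \<inter> {0..1} else {0..1})" for j
        have "(\<lambda>\<omega>. fst \<omega> i) -` A \<inter> space M = (\<Union>R\<in>{R. suborder {1..i} R}. basic_event i B R)"
          using False by (auto simp: M basic_event_def B_def Omega_def suborder_restrict_order[simplified] PiE_iff split: if_splits)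
        also have "\<dots> \<in> sets M"
          using False A by (intro sets.finite_UN finite_suborders basic) (auto simp: unit_borel_seq_def B_def)
        finally show "(\<lambda>\<omega>. fst \<omega> i) -` A \<inter> space M \<in> sets M" .
      qed simp
    qed
  next
    fix i j
    show "Measurable.pred M (\<lambda>\<omega>. snd \<omega> i j)"
    proof (cases "1 \<le> i \<and> i < j")
      case False
      then have "\<not> snd \<omega> i j" if "\<omega> \<in> space M" for \<omega>
        using that by (auto simp: M Omega_def suborder_def)
      then have "{\<omega> \<in> space M. snd \<omega> i j} = {}" by auto
      then show ?thesis unfolding pred_def by (metis sets.empty_sets)
    next
      case True
      then have "restrict_order j S i j = S i j" for S by (auto simp: restrict_order_def)
      then have "{\<omega> \<in> space M. snd \<omega> i j} =
          (\<Union>R\<in>{R. suborder {1..j} R \<and> R i j}. basic_event j (\<lambda>_. {0..1}) R)"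
        using True by (auto simp: M basic_event_def Omega_def suborder_restrict_order[simplified] PiE_iff)
      also have "\<dots> \<in> sets M"
        using True by (intro sets.finite_UN basic finite_subset[OF _ finite_suborders[of j]]) (auto simp: unit_borel_seq_def)
      finally show ?thesis unfolding pred_def .
    qed
  qed
  then show "sets (restrict_space borel Omega) \<subseteq> event_algebra"
    using M measurable_sets[of "\<lambda>\<omega>. \<omega>" M borel] by (auto simp: sets_restrict_space Int_commute)
qed

section \<open>Closed conditions in the weak topology\<close>

lemma prob_measuresD:
  assumes "\<mu> \<in> prob_measures"
  shows "prob_space \<mu>" "space \<mu> = Omega" "sets \<mu> = sets (restrict_space borel Omega)"
  using assms by (auto simp: prob_measures_def event_algebra_borel)

lemma borel_measurable_continuous_on_Omega:
  fixes f :: "point \<Rightarrow> 'b::topological_space"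
  assumes "\<mu> \<in> prob_measures" "continuous_on Omega f"
  shows "f \<in> borel_measurable \<mu>"
  using borel_measurable_continuous_on_restrict[OF assms(2)]
  by (simp add: measurable_cong_sets[OF prob_measuresD(3)[OF assms(1)] refl])

lemma integrable_bounded_continuous:
  fixes f :: "point \<Rightarrow> real"
  assumes \<mu>: "\<mu> \<in> prob_measures" and "continuous_on Omega f" "bounded (f ` Omega)"
  shows "integrable \<mu> f"
proof -
  interpret prob_space \<mu> using \<mu> by (rule prob_measuresD)
  obtain c where "\<And>\<omega>. \<omega> \<in> Omega \<Longrightarrow> norm (f \<omega>) \<le> c" using assms(3) by (auto simp: bounded_iff)
  then show ?thesis
    using \<mu> by (intro integrable_const_bound[of f c] borel_measurable_continuous_on_Omega assms)
      (auto simp: prob_measuresD intro!: AE_I2)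
qed

text \<open>
  \<open>prob_measures\<close> itself joins the intersection in the proof, so that an empty index set, as for
  \<open>\<Lambda>\<^bsup>1\<^esup>\<close>-invariance, is covered.
\<close>

lemma closedin_Collect_Ball_weak:
  assumes "\<And>i. i \<in> I \<Longrightarrow> closedin weak_topology {\<mu> \<in> prob_measures. P i \<mu>}"
  shows "closedin weak_topology {\<mu> \<in> prob_measures. \<forall>i\<in>I. P i \<mu>}"
proof -
  have "{\<mu> \<in> prob_measures. \<forall>i\<in>I. P i \<mu>} =
      \<Inter>(insert (topspace weak_topology) ((\<lambda>i. {\<mu> \<in> prob_measures. P i \<mu>}) ` I))"
    by (auto simp: topspace_weak_topology)
  also have "closedin weak_topology \<dots>"
    by (rule closedin_Inter) (use assms in auto)
  finally show ?thesis .
qed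

lemma closedin_integral_eq_0:
  fixes f :: "point \<Rightarrow> real"
  assumes "continuous_on Omega f" "bounded (f ` Omega)"
  shows "closedin weak_topology {\<mu> \<in> prob_measures. (\<integral>\<omega>. f \<omega> \<partial>\<mu>) = 0}"
proof -
  have "openin weak_topology {\<mu> \<in> prob_measures. (\<integral>\<omega>. f \<omega> \<partial>\<mu>) \<in> - {0}}"
    unfolding weak_topology_def
    by (rule topology_generated_by_Basis, intro CollectI exI[of _ f] exI[of _ "- {0}"])
      (use assms in auto)
  moreover have "prob_measures - {\<mu> \<in> prob_measures. (\<integral>\<omega>. f \<omega> \<partial>\<mu>) = 0} =
      {\<mu> \<in> prob_measures. (\<integral>\<omega>. f \<omega> \<partial>\<mu>) \<in> - {0}}" by auto
  ultimately show ?thesis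
    by (auto simp: closedin_def topspace_weak_topology)
qed

definition pushforward_on :: "point measure \<Rightarrow> point set \<Rightarrow> (point \<Rightarrow> point) \<Rightarrow> point measure" where
  "pushforward_on \<mu> C T = distr (restrict_space \<mu> (Omega \<inter> C)) borel T"

lemma sets_pushforward_on: "sets (pushforward_on \<mu> C T) = sets borel"
  by (simp add: pushforward_on_def)

context
  fixes \<mu> C and T :: "point \<Rightarrow> point"
  assumes \<mu>: "\<mu> \<in> prob_measures" and C: "open C" "closed C" and T: "continuous_on (Omega \<inter> C) T"
begin

lemma clopen_event: "Omega \<inter> C \<in> sets \<mu>"
  using C by (auto simp: prob_measuresD(3)[OF \<mu>] sets_restrict_space)

lemma measurable_on_clopen: "T \<in> borel_measurable (restrict_space \<mu> (Omega \<inter> C))"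
proof -
  have "sets (restrict_space \<mu> (Omega \<inter> C)) = sets (restrict_space (restrict_space borel Omega) (Omega \<inter> C))"
    by (rule sets_restrict_space_cong[OF prob_measuresD(3)[OF \<mu>]])
  also have "\<dots> = sets (restrict_space borel (Omega \<inter> C))"
    by (simp add: sets_restrict_restrict_space)
  finally have *: "sets (restrict_space \<mu> (Omega \<inter> C)) = sets (restrict_space borel (Omega \<inter> C))" .
  show ?thesis
    using borel_measurable_continuous_on_restrict[OF T] by (simp add: measurable_cong_sets[OF * refl])
qed

lemma finite_measure_pushforward_on: "finite_measure (pushforward_on \<mu> C T)"
proof -
  interpret prob_space \<mu> using \<mu> by (rule prob_measuresD)
  have "finite_measure (restrict_space \<mu> (Omega \<inter> C))"
    using clopen_event by (intro finite_measure_restrict_space) (auto simp: prob_measuresD[OF \<mu>])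
  then show ?thesis
    unfolding pushforward_on_def by (rule finite_measure.finite_measure_distr) (rule measurable_on_clopen)
qed

lemma emeasure_pushforward_on:
  assumes "E \<in> sets borel"
  shows "emeasure (pushforward_on \<mu> C T) E = emeasure \<mu> (Omega \<inter> C \<inter> T -` E)"
proof -
  have "emeasure (pushforward_on \<mu> C T) E =
      emeasure (restrict_space \<mu> (Omega \<inter> C)) (T -` E \<inter> (Omega \<inter> C))"
    unfolding pushforward_on_def using assms
    by (subst emeasure_distr[OF measurable_on_clopen]) (auto simp: space_restrict_space prob_measuresD[OF \<mu>] Int_ac)
  also have "\<dots> = emeasure \<mu> (T -` E \<inter> (Omega \<inter> C))"
    using clopen_event by (intro emeasure_restrict_space) (auto simp: prob_measuresD(2)[OF \<mu>] Int_absorb2)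
  finally show ?thesis by (simp add: Int_commute)
qed

lemma integral_pushforward_on:
  fixes f :: "point \<Rightarrow> real"
  assumes "continuous_on UNIV f"
  shows "(\<integral>\<omega>. f \<omega> \<partial>pushforward_on \<mu> C T) = (\<integral>\<omega>. (if \<omega> \<in> C then f (T \<omega>) else 0) \<partial>\<mu>)"
proof -
  have "(\<integral>\<omega>. f \<omega> \<partial>pushforward_on \<mu> C T) = (\<integral>\<omega>. f (T \<omega>) \<partial>restrict_space \<mu> (Omega \<inter> C))"
    unfolding pushforward_on_def
    by (intro integral_distr measurable_on_clopen borel_measurable_continuous_onI assms)
  also have "\<dots> = (\<integral>\<omega>. indicator (Omega \<inter> C) \<omega> *\<^sub>R f (T \<omega>) \<partial>\<mu>)"
    using clopen_event by (intro integral_restrict_space) (simp add: prob_measuresD(2)[OF \<mu>] Int_absorb2)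
  also have "\<dots> = (\<integral>\<omega>. (if \<omega> \<in> C then f (T \<omega>) else 0) \<partial>\<mu>)"
    by (intro Bochner_Integration.integral_cong) (auto simp: prob_measuresD[OF \<mu>] indicator_def)
  finally show ?thesis .
qed

end

lemma bounded_continuous_localized:
  fixes f :: "point \<Rightarrow> real" and T :: "point \<Rightarrow> point"
  assumes "open C" "closed C" "continuous_on (Omega \<inter> C) T" "continuous_on UNIV f" "bounded (range f)"
  shows "continuous_on Omega (\<lambda>\<omega>. if \<omega> \<in> C then f (T \<omega>) else 0)"
    and "bounded ((\<lambda>\<omega>. if \<omega> \<in> C then f (T \<omega>) else 0) ` Omega)"
proof -
  have "continuous_on (Omega \<inter> C) (\<lambda>\<omega>. f (T \<omega>))"
    by (rule continuous_on_compose2[OF assms(4,3)]) simp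
  then show "continuous_on Omega (\<lambda>\<omega>. if \<omega> \<in> C then f (T \<omega>) else 0)"
    using assms(1,2) by (intro continuous_on_If_clopen) auto
  have "(\<lambda>\<omega>. if \<omega> \<in> C then f (T \<omega>) else 0) ` Omega \<subseteq> insert 0 (range f)" by auto
  then show "bounded ((\<lambda>\<omega>. if \<omega> \<in> C then f (T \<omega>) else 0) ` Omega)"
    using assms(5) by (meson bounded_insert bounded_subset)
qed

text \<open>
  Equality of the two pushforwards is equivalent to the vanishing, for every bounded continuous
  \<open>f\<close>, of the integral of one bounded continuous function on \<open>\<Omega>\<close>. Each of these equations
  defines a closed set by the definition of the weak topology. Multiplying by the indicators of
  \<open>C\<close> and \<open>D\<close> does not destroy continuity because these sets are clopen.
\<close>

lemma closedin_equal_pushforwards: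
  fixes S T :: "point \<Rightarrow> point"
  assumes C: "open C" "closed C" "continuous_on (Omega \<inter> C) T"
    and D: "open D" "closed D" "continuous_on (Omega \<inter> D) S"
  shows "closedin weak_topology {\<mu> \<in> prob_measures.
    \<forall>E\<in>sets borel. emeasure \<mu> (Omega \<inter> C \<inter> T -` E) = emeasure \<mu> (Omega \<inter> D \<inter> S -` E)}"
proof -
  let ?F = "{f :: point \<Rightarrow> real. continuous_on UNIV f \<and> bounded (range f)}"
  let ?h = "\<lambda>(f :: point \<Rightarrow> real) (\<omega>::point). (if \<omega> \<in> C then f (T \<omega>) else 0) - (if \<omega> \<in> D then f (S \<omega>) else 0) :: real"
  have "(\<forall>E\<in>sets borel. emeasure \<mu> (Omega \<inter> C \<inter> T -` E) = emeasure \<mu> (Omega \<inter> D \<inter> S -` E)) \<longleftrightarrow>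
      (\<forall>f\<in>?F. (\<integral>\<omega>. ?h f \<omega> \<partial>\<mu>) = 0)" (is "?L \<longleftrightarrow> ?R") if \<mu>: "\<mu> \<in> prob_measures" for \<mu>
  proof -
    have "?L \<longleftrightarrow> pushforward_on \<mu> C T = pushforward_on \<mu> D S"
    proof
      assume ?L
      then show "pushforward_on \<mu> C T = pushforward_on \<mu> D S"
        using emeasure_pushforward_on[OF \<mu> C] emeasure_pushforward_on[OF \<mu> D]
        by (intro measure_eqI) (simp_all add: sets_pushforward_on)
    next
      assume "pushforward_on \<mu> C T = pushforward_on \<mu> D S"
      then show ?L
        using emeasure_pushforward_on[OF \<mu> C] emeasure_pushforward_on[OF \<mu> D] by simp
    qed
    also have "\<dots> \<longleftrightarrow> (\<forall>f\<in>?F. (\<integral>\<omega>. f \<omega> \<partial>pushforward_on \<mu> C T) = (\<integral>\<omega>. f \<omega> \<partial>pushforward_on \<mu> D S))"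
    proof
      assume "\<forall>f\<in>?F. (\<integral>\<omega>. f \<omega> \<partial>pushforward_on \<mu> C T) = (\<integral>\<omega>. f \<omega> \<partial>pushforward_on \<mu> D S)"
      then show "pushforward_on \<mu> C T = pushforward_on \<mu> D S"
        by (intro measure_eqI_bounded_continuous finite_measure_pushforward_on \<mu> C D)
          (auto simp: sets_pushforward_on)
    qed simp
    also have "\<dots> \<longleftrightarrow> ?R"
    proof (intro ball_cong refl)
      fix f assume "f \<in> ?F"
      then have f: "continuous_on UNIV f" "bounded (range f)" by auto
      have "(\<integral>\<omega>. ?h f \<omega> \<partial>\<mu>) = (\<integral>\<omega>. f \<omega> \<partial>pushforward_on \<mu> C T) - (\<integral>\<omega>. f \<omega> \<partial>pushforward_on \<mu> D S)"
        unfolding integral_pushforward_on[OF \<mu> C f(1)] integral_pushforward_on[OF \<mu> D f(1)]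
        by (intro Bochner_Integration.integral_diff integrable_bounded_continuous[OF \<mu>]
            bounded_continuous_localized C D f)
      then show "(\<integral>\<omega>. f \<omega> \<partial>pushforward_on \<mu> C T) = (\<integral>\<omega>. f \<omega> \<partial>pushforward_on \<mu> D S) \<longleftrightarrow> (\<integral>\<omega>. ?h f \<omega> \<partial>\<mu>) = 0"
        by simp
    qed
    finally show ?thesis .
  qed
  then have "{\<mu> \<in> prob_measures.
      \<forall>E\<in>sets borel. emeasure \<mu> (Omega \<inter> C \<inter> T -` E) = emeasure \<mu> (Omega \<inter> D \<inter> S -` E)} =
      {\<mu> \<in> prob_measures. \<forall>f\<in>?F. (\<integral>\<omega>. ?h f \<omega> \<partial>\<mu>) = 0}" by blast
  also have "closedin weak_topology \<dots>"
  proof (rule closedin_Collect_Ball_weak)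
    fix f assume "f \<in> ?F"
    then have f: "continuous_on UNIV f" "bounded (range f)" by auto
    show "closedin weak_topology {\<mu> \<in> prob_measures. (\<integral>\<omega>. ?h f \<omega> \<partial>\<mu>) = 0}"
      by (intro closedin_integral_eq_0 continuous_on_diff bounded_minus_comp bounded_continuous_localized C D f)
  qed
  finally show ?thesis .
qed

section \<open>Invariance under an adjacent transposition\<close>

text \<open>
  The transposition of \<open>i\<close> and \<open>i + 1\<close> changes the standard order of no pair other than
  \<open>(i, i + 1)\<close>, which is unrelated in \<open>R\<close>.
\<close>

lemma suborder_permute_transpose:
  assumes R: "suborder {1..} R" and inc: "\<not> R i (i + 1)" and i: "1 \<le> i"
  shows "suborder {1..} (permute_order (Transposition.transpose i (i + 1)) R)"
proof -
  let ?t = "Transposition.transpose i (i + 1)"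
  have "a \<in> {1..} \<and> b \<in> {1..} \<and> a < b" if "R (?t a) (?t b)" for a b
  proof -
    have *: "1 \<le> ?t a" "1 \<le> ?t b" "?t a < ?t b" "\<not> (?t a = i \<and> ?t b = i + 1)"
      using R inc that by (auto simp: suborder_def)
    have "1 \<le> a" "1 \<le> b"
      using *(1,2) i by (auto simp: Transposition.transpose_def split: if_splits)
    moreover have "a < b"
      using *(3,4) by (auto simp: Transposition.transpose_def split: if_splits)
    ultimately show ?thesis by simp
  qed
  moreover have "irreflp (permute_order ?t R)" "transp (permute_order ?t R)"
    using R by (auto simp: suborder_def permute_order_def irreflp_def transp_def)
  ultimately show ?thesis
    unfolding suborder_def permute_order_def by blast
qed

lemma swap_map_in_Omega:
  assumes "\<omega> \<in> Omega" "1 \<le> i"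
  shows "swap_map i \<omega> \<in> Omega"
proof -
  obtain x R where \<omega>: "\<omega> = (x, R)" by fastforce
  have "(\<lambda>j. x (Transposition.transpose i (i + 1) j)) \<in> {1..} \<rightarrow>\<^sub>E {0..1}"
    using assms by (auto simp: \<omega> Omega_def PiE_iff extensional_def Transposition.transpose_def)
  then show ?thesis
    using assms suborder_permute_transpose[of R i] by (auto simp: \<omega> Omega_def swap_map_def)
qed

lemma swap_map_involution: "swap_map i (swap_map i \<omega>) = \<omega>"
  by (cases \<omega>) (auto simp: swap_map_def permute_order_def)

text \<open>
  Since \<open>\<lambda>\<^bsup>(i)\<^esup>\<close> is an involution of \<open>\<Omega>\<close>, the forward image in the definition of \<open>\<mu> \<circ> \<lambda>\<^bsup>(i)\<^esup>\<close> is a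
  preimage, so \<open>\<mu> \<circ> \<lambda>\<^bsup>(i)\<^esup>\<close> is a pushforward measure.
\<close>

lemma swap_map_image:
  assumes "1 \<le> i"
  shows "swap_map i ` (Omega \<inter> D) = Omega \<inter> swap_map i -` D"
proof
  show "Omega \<inter> swap_map i -` D \<subseteq> swap_map i ` (Omega \<inter> D)"
  proof
    fix \<omega> assume "\<omega> \<in> Omega \<inter> swap_map i -` D"
    then have "swap_map i \<omega> \<in> Omega \<inter> D" using swap_map_in_Omega[OF _ assms] by auto
    then show "\<omega> \<in> swap_map i ` (Omega \<inter> D)"
      by (rule image_eqI[rotated]) (simp add: swap_map_involution)
  qed
qed (use swap_map_in_Omega[OF _ assms] swap_map_involution[of i] in auto)

lemma continuous_on_permute:
  "continuous_on A (\<lambda>\<omega>::point. ((\<lambda>j. fst \<omega> (l j)), permute_order l (snd \<omega>)))"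
  by (rule continuous_on_point)
    (simp_all add: permute_order_def continuous_on_label continuous_on_relation)

lemma continuous_on_swap_map: "continuous_on A (swap_map i)"
proof -
  let ?C = "{\<omega>::point. snd \<omega> i (i + 1) = False} \<inter> {\<omega>. snd \<omega> (i + 1) i = False}"
  have "continuous_on A (\<lambda>\<omega>. if \<omega> \<in> ?C
      then ((\<lambda>j. fst \<omega> (Transposition.transpose i (i + 1) j)),
        permute_order (Transposition.transpose i (i + 1)) (snd \<omega>)) else \<omega>)"
    by (intro continuous_on_If_clopen open_Int closed_Int clopen_relation continuous_on_permute
        continuous_on_id)
  also have "(\<lambda>\<omega>. if \<omega> \<in> ?C
      then ((\<lambda>j. fst \<omega> (Transposition.transpose i (i + 1) j)),
        permute_order (Transposition.transpose i (i + 1)) (snd \<omega>)) else \<omega>) = swap_map i"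
    by (auto simp: fun_eq_iff swap_map_def)
  finally show ?thesis .
qed

lemma closedin_swap_invariant:
  assumes "1 \<le> i"
  shows "closedin weak_topology {\<mu> \<in> prob_measures. swap_invariant i \<mu>}"
proof -
  have "swap_invariant i \<mu> \<longleftrightarrow> (\<forall>D\<in>sets borel. emeasure \<mu> (Omega \<inter> UNIV \<inter> id -` D) =
      emeasure \<mu> (Omega \<inter> UNIV \<inter> swap_map i -` D))" for \<mu>
    unfolding swap_invariant_def comp_swap_def event_algebra_borel sets_restrict_space
    by (simp add: swap_map_image[OF assms])
  then show ?thesis
    using closedin_equal_pushforwards[of UNIV id UNIV "swap_map i"]
    by (simp add: continuous_on_swap_map)
qed

section \<open>Order-invariance\<close>

text \<open>
  The vector \<open>(x\<^bsub>l(1)\<^esub>, \<dots>, x\<^bsub>l(k)\<^esub>)\<close>, padded with zeros and the empty order to an element of \<open>point\<close>,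
  so that \<open>closedin_equal_pushforwards\<close> applies to it. The order can be forgotten because the
  order on \<open>{1..k}\<close> is constant on the clopen sets on which this map is used.
\<close>

definition first_labels :: "nat \<Rightarrow> (nat \<Rightarrow> nat) \<Rightarrow> point \<Rightarrow> point" where
  "first_labels k l \<omega> = ((\<lambda>i. if i \<in> {1..k} then fst \<omega> (l i) else 0), \<lambda>_ _. False)"

lemma continuous_on_first_labels: "continuous_on A (first_labels k l)"
proof (rule continuous_on_point)
  show "continuous_on A (\<lambda>\<omega>. fst (first_labels k l \<omega>) i)" for i
    unfolding first_labels_def fst_conv
    by (cases "i \<in> {1..k}") (simp_all only: if_True if_False continuous_on_label continuous_on_const)
qed (simp add: first_labels_def)

lemma basic_event_reindex:
  assumes "l permutes {1..k}"
  shows "basic_event k B R = Omega \<inter> {\<omega>. restrict_order k (snd \<omega>) = R} \<inter>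
    {\<omega>. \<forall>i\<in>{1..k}. fst \<omega> (l i) \<in> B (l i)}"
proof -
  have "(\<forall>i\<in>{1..k}. P (l i)) \<longleftrightarrow> (\<forall>i\<in>{1..k}. P i)" for P
    using permutes_image[OF assms] by (metis imageE imageI)
  from this[of "\<lambda>j. x j \<in> B j" for x] show ?thesis
    by (auto simp: basic_event_def)
qed

text \<open>
  The same vector in the finite product space, where agreement on boxes is enough for equality of
  laws.
\<close>

definition label_law ::
    "point measure \<Rightarrow> point set \<Rightarrow> nat \<Rightarrow> (nat \<Rightarrow> nat) \<Rightarrow> (nat \<Rightarrow> real) measure" where
  "label_law \<mu> C k l = distr (pushforward_on \<mu> C (first_labels k l)) (Pi\<^sub>M {1..k} (\<lambda>_. borel))
     (\<lambda>\<omega>. restrict (fst \<omega>) {1..k})"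

lemma sets_label_law: "sets (label_law \<mu> C k l) = sets (Pi\<^sub>M {1..k} (\<lambda>_. borel))"
  by (simp add: label_law_def)

lemma emeasure_label_law:
  assumes \<mu>: "\<mu> \<in> prob_measures" and C: "open C" "closed C"
    and X: "X \<in> sets (Pi\<^sub>M {1..k} (\<lambda>_. borel))"
  shows "emeasure (label_law \<mu> C k l) X =
    emeasure \<mu> (Omega \<inter> C \<inter> {\<omega>. (\<lambda>i\<in>{1..k}. fst \<omega> (l i)) \<in> X})"
proof -
  let ?r = "\<lambda>\<omega>::point. restrict (fst \<omega>) {1..k}"
  have r: "?r \<in> borel \<rightarrow>\<^sub>M Pi\<^sub>M {1..k} (\<lambda>_. borel)"
    by (intro measurable_restrict borel_measurable_continuous_onI continuous_on_label)
  have "?r \<in> pushforward_on \<mu> C (first_labels k l) \<rightarrow>\<^sub>M Pi\<^sub>M {1..k} (\<lambda>_. borel)"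
    using r by (simp add: measurable_cong_sets[OF sets_pushforward_on refl])
  then have "emeasure (label_law \<mu> C k l) X = emeasure (pushforward_on \<mu> C (first_labels k l)) (?r -` X)"
    unfolding label_law_def using X
    by (simp add: emeasure_distr sets_eq_imp_space_eq[OF sets_pushforward_on])
  also have "\<dots> = emeasure \<mu> (Omega \<inter> C \<inter> first_labels k l -` (?r -` X))"
    using measurable_sets[OF r X]
    by (intro emeasure_pushforward_on \<mu> C continuous_on_first_labels) simp
  also have "first_labels k l -` (?r -` X) = {\<omega>. (\<lambda>i\<in>{1..k}. fst \<omega> (l i)) \<in> X}"
  proof -
    have "?r (first_labels k l \<omega>) = (\<lambda>i\<in>{1..k}. fst \<omega> (l i))" for \<omega>
      by (auto simp: first_labels_def)
    then show ?thesis by (simp only: vimage_def mem_Collect_eq)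
  qed
  finally show ?thesis .
qed

text \<open>
  The padded vector is a Borel function of the vector in the finite product space.
\<close>

lemma label_law_determines_first_labels:
  assumes \<mu>: "\<mu> \<in> prob_measures" and C: "open C" "closed C" and D: "open D" "closed D"
    and law: "label_law \<mu> C k l = label_law \<mu> D k m" and E: "E \<in> sets borel"
  shows "emeasure \<mu> (Omega \<inter> C \<inter> first_labels k l -` E) = emeasure \<mu> (Omega \<inter> D \<inter> first_labels k m -` E)"
proof -
  define pad :: "(nat \<Rightarrow> real) \<Rightarrow> point" where
    "pad y = ((\<lambda>i. if i \<in> {1..k} then y i else 0), \<lambda>_ _. False)" for y
  have "pad \<in> borel_measurable (Pi\<^sub>M {1..k} (\<lambda>_. borel))"
  proof (rule borel_measurable_point)
    fix i
    show "(\<lambda>y. fst (pad y) i) \<in> borel_measurable (Pi\<^sub>M {1..k} (\<lambda>_. borel))"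
    proof (cases "i \<in> {1..k}")
      case True
      from measurable_component_singleton[OF this, of "\<lambda>_. borel"] show ?thesis
        unfolding pad_def fst_conv by (simp only: True if_True)
    next
      case False
      then show ?thesis unfolding pad_def fst_conv by (simp only: if_False borel_measurable_const)
    qed
  qed (simp add: pad_def)
  from measurable_sets[OF this E]
  have pad: "pad -` E \<inter> space (Pi\<^sub>M {1..k} (\<lambda>_. borel)) \<in> sets (Pi\<^sub>M {1..k} (\<lambda>_. borel))" .
  have "first_labels k l \<omega> = pad (\<lambda>i\<in>{1..k}. fst \<omega> (l i))" for l \<omega>
    by (auto simp: first_labels_def pad_def)
  then have *: "first_labels k l -` E =
      {\<omega>. (\<lambda>i\<in>{1..k}. fst \<omega> (l i)) \<in> pad -` E \<inter> space (Pi\<^sub>M {1..k} (\<lambda>_. borel))}" for l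
    by (auto simp: space_PiM)
  show ?thesis
    unfolding * using law emeasure_label_law[OF \<mu> C pad, of l] emeasure_label_law[OF \<mu> D pad, of m] by simp
qed

text \<open>
  Reindexing the label conditions of \<open>E(B\<^sub>1 \<dots> B\<^sub>k, R)\<close> along \<open>l\<close> turns them into
  \<open>x\<^bsub>l(i)\<^esub> \<in> B\<^bsub>l(i)\<^esub>\<close>, which is the box on which \<open>E(B\<^bsub>l(1)\<^esub> \<dots> B\<^bsub>l(k)\<^esub>, l[R])\<close> tests
  \<open>(x\<^sub>1, \<dots>, x\<^sub>k)\<close>. Hence agreement on basic events is agreement of two finite-dimensional laws on
  boxes, and therefore on all Borel sets.
\<close>

lemma basic_events_agree_iff:
  assumes \<mu>: "\<mu> \<in> prob_measures" and l: "l permutes {1..k}"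
  shows "(\<forall>B. unit_borel_seq k B \<longrightarrow> emeasure \<mu> (basic_event k B R) =
        emeasure \<mu> (basic_event k (\<lambda>i. B (l i)) (permute_order l R))) \<longleftrightarrow>
    (\<forall>E\<in>sets borel.
      emeasure \<mu> (Omega \<inter> {\<omega>. restrict_order k (snd \<omega>) = R} \<inter> first_labels k l -` E) =
      emeasure \<mu> (Omega \<inter> {\<omega>. restrict_order k (snd \<omega>) = permute_order l R} \<inter> first_labels k id -` E))"
    (is "?L \<longleftrightarrow> ?R")
proof -
  define C where "C S = {\<omega>::point. restrict_order k (snd \<omega>) = S}" for S
  have C: "open (C S)" "closed (C S)" for S
    unfolding C_def by (rule clopen_restrict_order)+
  have l_in: "l i \<in> {1..k}" if "i \<in> {1..k}" for i
    using permutes_in_image[OF l] that by simp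
  have basic: "basic_event k B R = Omega \<inter> C R \<inter> {\<omega>. \<forall>i\<in>{1..k}. fst \<omega> (l i) \<in> B (l i)}"
    "basic_event k (\<lambda>i. B (l i)) (permute_order l R) =
      Omega \<inter> C (permute_order l R) \<inter> {\<omega>. \<forall>i\<in>{1..k}. fst \<omega> i \<in> B (l i)}" for B
    unfolding C_def using basic_event_reindex[OF l] basic_event_reindex[OF permutes_id] by simp_all
  have "?R" if ?L
  proof -
    have "label_law \<mu> (C R) k l = label_law \<mu> (C (permute_order l R)) k id"
    proof (rule measure_eqI_PiM_finite)
      fix A :: "nat \<Rightarrow> real set" assume A: "\<And>i. i \<in> {1..k} \<Longrightarrow> A i \<in> sets borel"
      \<comment> \<open>Chosen so that \<open>B (l i)\<close> is the \<open>i\<close>-th side of the given box, cut down to the unit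
        interval in which the labels lie.\<close>
      define B where "B j = A (inv l j) \<inter> {0..1}" for j
      have "inv l j \<in> {1..k}" if "j \<in> {1..k}" for j
        using permutes_in_image[OF permutes_inv[OF l]] that by simp
      then have "unit_borel_seq k B" using A by (auto simp: unit_borel_seq_def B_def)
      have "fst \<omega> i \<in> {0..1}" if "\<omega> \<in> Omega" "i \<in> {1..k}" for \<omega> i
        using that by (auto simp: Omega_def PiE_iff)
      moreover have "B (l i) = A i \<inter> {0..1}" for i
        by (simp add: B_def permutes_inverses[OF l])
      ultimately have
        "basic_event k B R = Omega \<inter> C R \<inter> {\<omega>. (\<lambda>i\<in>{1..k}. fst \<omega> (l i)) \<in> Pi\<^sub>E {1..k} A}"
        "basic_event k (\<lambda>i. B (l i)) (permute_order l R) =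
          Omega \<inter> C (permute_order l R) \<inter> {\<omega>. (\<lambda>i\<in>{1..k}. fst \<omega> (id i)) \<in> Pi\<^sub>E {1..k} A}"
        unfolding basic using l_in by (auto simp: PiE_iff)
      moreover have "emeasure \<mu> (basic_event k B R) = emeasure \<mu> (basic_event k (\<lambda>i. B (l i)) (permute_order l R))"
        by (rule \<open>?L\<close>[rule_format]) fact
      moreover have "Pi\<^sub>E {1..k} A \<in> sets (Pi\<^sub>M {1..k} (\<lambda>_. borel))"
        using A by (intro sets_PiM_I_finite) auto
      ultimately show "emeasure (label_law \<mu> (C R) k l) (Pi\<^sub>E {1..k} A) =
          emeasure (label_law \<mu> (C (permute_order l R)) k id) (Pi\<^sub>E {1..k} A)"
        by (simp only: emeasure_label_law[OF \<mu> C])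
    next
      show "range (\<lambda>_::nat. space (Pi\<^sub>M {1..k} (\<lambda>_. borel))) \<subseteq> prod_algebra {1..k} (\<lambda>_. borel :: real measure)"
        unfolding space_PiM by (auto intro!: prod_algebraI_finite)
      interpret prob_space \<mu> using \<mu> by (rule prob_measuresD)
      show "emeasure (label_law \<mu> (C R) k l) (space (Pi\<^sub>M {1..k} (\<lambda>_. borel))) \<noteq> \<infinity>"
        by (simp add: emeasure_label_law[OF \<mu> C] sets.top)
    qed (simp_all add: sets_label_law)
    from label_law_determines_first_labels[OF \<mu> C C this] show ?R by (simp add: C_def)
  qed
  moreover have "?L" if ?R
  proof (intro allI impI)
    fix B assume B: "unit_borel_seq k B"
    define E where "E = {\<omega>::point. \<forall>i\<in>{1..k}. fst \<omega> i \<in> B (l i)}"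
    have "(\<lambda>\<omega>::point. fst \<omega> i) -` B (l i) \<in> sets borel" if "i \<in> {1..k}" for i
      using B l_in[OF that]
        measurable_sets[OF borel_measurable_continuous_onI[OF continuous_on_label], of "B (l i)" i]
      by (simp add: unit_borel_seq_def)
    then have "(\<Inter>i\<in>{1..k}. (\<lambda>\<omega>::point. fst \<omega> i) -` B (l i)) \<in> sets borel"
      by (cases "k = 0") (auto intro!: sets.finite_INT)
    also have "(\<Inter>i\<in>{1..k}. (\<lambda>\<omega>::point. fst \<omega> i) -` B (l i)) = E" by (auto simp: E_def)
    finally have E: "E \<in> sets borel" .
    have "basic_event k B R = Omega \<inter> C R \<inter> first_labels k l -` E"
      "basic_event k (\<lambda>i. B (l i)) (permute_order l R) =
        Omega \<inter> C (permute_order l R) \<inter> first_labels k id -` E"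
      unfolding basic by (auto simp: E_def first_labels_def)
    then show "emeasure \<mu> (basic_event k B R) = emeasure \<mu> (basic_event k (\<lambda>i. B (l i)) (permute_order l R))"
      using \<open>?R\<close> E by (simp add: C_def)
  qed
  ultimately show ?thesis by blast
qed

lemma closedin_order_invariant: "closedin weak_topology {\<mu> \<in> prob_measures. order_invariant \<mu>}"
proof -
  let ?I = "{(k, R, l). 1 \<le> k \<and> suborder {1..k} R \<and> linear_extension k R l}"
  let ?P = "\<lambda>(k, R, l) \<mu>. \<forall>D\<in>sets borel.
      emeasure \<mu> (Omega \<inter> {\<omega>. restrict_order k (snd \<omega>) = R} \<inter> first_labels k l -` D) =
      emeasure \<mu> (Omega \<inter> {\<omega>. restrict_order k (snd \<omega>) = permute_order l R} \<inter> first_labels k id -` D)"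
  have "order_invariant \<mu> \<longleftrightarrow> (\<forall>p\<in>?I. ?P p \<mu>)" if \<mu>: "\<mu> \<in> prob_measures" for \<mu>
  proof -
    have "order_invariant \<mu> \<longleftrightarrow> (\<forall>k R l. 1 \<le> k \<and> suborder {1..k} R \<and> linear_extension k R l \<longrightarrow>
      (\<forall>B. unit_borel_seq k B \<longrightarrow> emeasure \<mu> (basic_event k B R) =
        emeasure \<mu> (basic_event k (\<lambda>i. B (l i)) (permute_order l R))))"
      unfolding order_invariant_def by blast
    also have "\<dots> \<longleftrightarrow> (\<forall>k R l. 1 \<le> k \<and> suborder {1..k} R \<and> linear_extension k R l \<longrightarrow> ?P (k, R, l) \<mu>)"
      using basic_events_agree_iff[OF \<mu>] by (simp add: linear_extension_def)
    finally show ?thesis by auto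
  qed
  then have "{\<mu> \<in> prob_measures. order_invariant \<mu>} = {\<mu> \<in> prob_measures. \<forall>p\<in>?I. ?P p \<mu>}"
    by blast
  also have "closedin weak_topology \<dots>"
    by (rule closedin_Collect_Ball_weak)
      (auto intro!: closedin_equal_pushforwards clopen_restrict_order continuous_on_first_labels)
  finally show ?thesis .
qed

theorem theorem6p5:
  shows "(\<forall>i\<ge>1. closedin weak_topology {\<mu> \<in> prob_measures. swap_invariant i \<mu>})
    \<and> (\<forall>k\<ge>1. closedin weak_topology {\<mu> \<in> prob_measures. Lambda_invariant k \<mu>})
    \<and> closedin weak_topology {\<mu> \<in> prob_measures. order_invariant \<mu>}"
proof (intro conjI allI impI)
  fix k :: nat
  show "closedin weak_topology {\<mu> \<in> prob_measures. Lambda_invariant k \<mu>}"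
    unfolding Lambda_invariant_def
    by (rule closedin_Collect_Ball_weak) (simp add: closedin_swap_invariant)
qed (simp_all add: closedin_swap_invariant closedin_order_invariant)

end
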